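(* Let $d$ be a positive integer, let $\Gamma$ be a closed subgroup of $\mathrm{E}(d)$, the isometry group of the Euclidean space $(\mathbb{R}^d,\rho)$, and let $D\subset\mathbb{R}^d$ be a Delone set. For $x\in D$ set $$V_x=\{y\in\mathbb{R}^d\mid \rho(x,y)<\rho(x',y)\text{ for any }x'\in D\setminus\{x\}\},\qquad U_x=V_x\setminus\{x\},$$ and let $\mathcal{T}=\{U_x\mid x\in D\}$ (a tiling of $\mathbb{R}^d$). Regard $D$ as an element of $\mathrm{UD}(\mathbb{R}^d)$ and $\mathcal{T}$ as an element of $\mathrm{Patch}(\mathbb{R}^d)$, both of which are abstract pattern spaces over $(\mathbb{R}^d,\Gamma)$. Then $D$ and $\mathcal{T}$ are mutually locally derivable.
   Context: $B(x,r)$ denotes the closed ball; $\mathrm{Cl}(X)$ is the set of closed subsets of $X$. $D\subset\mathbb{R}^d$ is uniformly discrete if for some $r>0$, $\rho(x,y)>r$ for all distinct $x,y\in D$; relatively dense if for some $R>0$, $D$ meets the interior of $B(x,R)$ for every $x$; Delone if both. Abstract pattern space over $(X,\Gamma)$ ($\Gamma$ acting on $X$ by homeomorphisms): a non-empty set $\Pi$ with a map $\Pi\times\mathrm{Cl}(X)\to\Pi$, $(\mathcal{P},C)\mapsto\mathcal{P}\wedge C$ and an action of $\Gamma$ on $\Pi$ such that (1) $(\mathcal{P}\wedge C_1)\wedge C_2=\mathcal{P}\wedge(C_1\cap C_2)$; (2) for each $\mathcal{P}$ there is a (unique) closed set $\operatorname{supp}\mathcal{P}$ with $\mathcal{P}\wedge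 C=\mathcal{P}\iff C\supset\operatorname{supp}\mathcal{P}$ for all closed $C$; (3) $(\gamma\mathcal{P})\wedge(\gamma C)=\gamma(\mathcal{P}\wedge C)$. Instances: (i) $\mathrm{UD}(\mathbb{R}^d)$, the set of uniformly discrete subsets, with $D\wedge C=D\cap C$ and $\gamma D=\{\gamma x\mid x\in D\}$. (ii) $\mathrm{Patch}(\mathbb{R}^d)$: a tile is an open, non-empty, bounded subset of $\mathbb{R}^d$; a patch is a set $\mathcal{P}$ of tiles such that any $S,T\in\mathcal{P}$ satisfy $S=T$ or $S\cap T=\emptyset$; $\mathcal{P}\wedge C=\{T\in\mathcal{P}\mid T\subset C\}$, $\gamma\mathcal{P}=\{\gamma T\mid T\in\mathcal{P}\}$, and $\operatorname{supp}\mathcal{P}=\overline{\bigcup_{T\in\mathcal{P}}T}$; a tiling is a patch with support $\mathbb{R}^d$. Local derivability: for abstract patterns $\mathcal{P}_1,\mathcal{P}_2$ in abstract pattern spaces over $(X,\Gamma)$, $(Y,\Gamma)$ ($\Gamma$ acting by isometries on proper metric spaces), $\mathcal{P}_2$ is locally derivable from $\mathcal{P}_1$ if there are $x_0\in X$, $y_0\in Y$, $R_0\geqq0$ such that for all $\gamma,\eta\in\Gamma$, $R\geqq0$: $(\gamma\mathcal{P}_1)\wedge B(x_0,R+R_0)=(\eta\mathcal{P}_1)\wedge B(x_0,R+R_0)$ implies $(\gamma\mathcal{P}_2)\wedge B(y_0,R)=(\eta\mathcal{P}_2)\wedge B(y_0,R)$. They are mutually locally derivable if each is locally derivable from the other.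 *)

theory Defs
  imports "HOL-Analysis.Analysis" "HOL-Algebra.Group_Action"
begin

subsection \<open>Isometry groups\<close>

definition isometry_group :: "('a::metric_space \<Rightarrow> 'a) monoid" where
  "isometry_group =
     \<lparr>carrier = {f. bij f \<and> (\<forall>x y. dist (f x) (f y) = dist x y)},
      monoid.mult = (\<circ>), one = id\<rparr>"

text \<open>
  The topology of the isometry group is the one inherited from the product topology on the
  function type, i.e. pointwise convergence. On isometries of a Euclidean space it agrees with
  the compact-open topology and with the usual topology of the semidirect product of the
  translations and the orthogonal group.
\<close>

definition closed_isometry_subgroup :: "('a::metric_space \<Rightarrow> 'a) set \<Rightarrow> bool" where
  "closed_isometry_subgroup \<Gamma> \<longleftrightarrow>
     subgroup \<Gamma> isometry_group \<and> closedin (top_of_set (carrier isometry_group)) \<Gamma>"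

abbreviation (input) subgroup_of_isometries :: "('a::metric_space \<Rightarrow> 'a) set \<Rightarrow> ('a \<Rightarrow> 'a) monoid" where
  "subgroup_of_isometries \<Gamma> \<equiv> isometry_group\<lparr>carrier := \<Gamma>\<rparr>"

subsection \<open>Abstract pattern spaces and local derivability\<close>

record ('g, 'x, 'p) pattern_space =
  patterns :: "'p set"
  cut :: "'p \<Rightarrow> 'x set \<Rightarrow> 'p"
  act :: "'g \<Rightarrow> 'p \<Rightarrow> 'p"

text \<open>
  The space \<open>X\<close> is the universe of a type. Only the values of \<open>cut S\<close> at closed sets matter.
  As \<^locale>\<open>group_action\<close> works with extensional bijections, \<open>act S g\<close> is
  \<^const>\<open>undefined\<close> outside \<open>patterns S\<close>.
\<close>

locale abstract_pattern_space =
  fixes G :: "('g, 'm) monoid_scheme"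
    and \<alpha> :: "'g \<Rightarrow> 'x::topological_space \<Rightarrow> 'x"
    and S :: "('g, 'x, 'p, 'z) pattern_space_scheme"
  assumes action_on_points: "group_action G UNIV \<alpha>"
    and homeomorphic_action: "g \<in> carrier G \<Longrightarrow> \<exists>h. homeomorphism UNIV UNIV (\<alpha> g) h"
    and action_on_patterns: "group_action G (patterns S) (act S)"
    and patterns_nonempty: "patterns S \<noteq> {}"
    and cut_closed: "\<lbrakk>P \<in> patterns S; closed C\<rbrakk> \<Longrightarrow> cut S P C \<in> patterns S"
    and cut_cut: "\<lbrakk>P \<in> patterns S; closed C1; closed C2\<rbrakk>
          \<Longrightarrow> cut S (cut S P C1) C2 = cut S P (C1 \<inter> C2)"
    and supp_exists: "P \<in> patterns S
          \<Longrightarrow> \<exists>!K. closed K \<and> (\<forall>C. closed C \<longrightarrow> (cut S P C = P \<longleftrightarrow> K \<subseteq> C))"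
    and cut_equivariant: "\<lbrakk>P \<in> patterns S; closed C; g \<in> carrier G\<rbrakk>
          \<Longrightarrow> cut S (act S g P) (\<alpha> g ` C) = act S g (cut S P C)"

definition pattern_supp :: "('g, 'x::topological_space, 'p, 'z) pattern_space_scheme \<Rightarrow> 'p \<Rightarrow> 'x set" where
  "pattern_supp S P = (THE K. closed K \<and> (\<forall>C. closed C \<longrightarrow> (cut S P C = P \<longleftrightarrow> K \<subseteq> C)))"

text \<open>
  \<open>locally_derivable G S1 P1 S2 P2\<close>: the pattern \<open>P2\<close> of \<open>S2\<close> is locally derivable from the
  pattern \<open>P1\<close> of \<open>S1\<close>. Proper metric spaces are the types of class \<^class>\<open>heine_borel\<close>.
\<close>

definition locally_derivable ::
  "('g, 'm) monoid_scheme \<Rightarrow> ('g, 'x::heine_borel, 'p, 'z) pattern_space_scheme \<Rightarrow> 'p \<Rightarrow>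
   ('g, 'y::heine_borel, 'q, 'w) pattern_space_scheme \<Rightarrow> 'q \<Rightarrow> bool" where
  "locally_derivable G S1 P1 S2 P2 \<longleftrightarrow>
     (\<exists>x0 y0. \<exists>R0\<ge>0. \<forall>\<gamma>\<in>carrier G. \<forall>\<eta>\<in>carrier G. \<forall>R\<ge>0.
        cut S1 (act S1 \<gamma> P1) (cball x0 (R + R0)) = cut S1 (act S1 \<eta> P1) (cball x0 (R + R0))
        \<longrightarrow> cut S2 (act S2 \<gamma> P2) (cball y0 R) = cut S2 (act S2 \<eta> P2) (cball y0 R))"

definition mutually_locally_derivable ::
  "('g, 'm) monoid_scheme \<Rightarrow> ('g, 'x::heine_borel, 'p, 'z) pattern_space_scheme \<Rightarrow> 'p \<Rightarrow>
   ('g, 'y::heine_borel, 'q, 'w) pattern_space_scheme \<Rightarrow> 'q \<Rightarrow> bool" where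
  "mutually_locally_derivable G S1 P1 S2 P2 \<longleftrightarrow>
     locally_derivable G S1 P1 S2 P2 \<and> locally_derivable G S2 P2 S1 P1"

subsection \<open>Uniformly discrete sets and patches\<close>

definition uniformly_discrete :: "'a::metric_space set \<Rightarrow> bool" where
  "uniformly_discrete D \<longleftrightarrow> (\<exists>r>0. \<forall>x\<in>D. \<forall>y\<in>D. x \<noteq> y \<longrightarrow> dist x y > r)"

definition relatively_dense :: "'a::metric_space set \<Rightarrow> bool" where
  "relatively_dense D \<longleftrightarrow> (\<exists>R>0. \<forall>x. D \<inter> interior (cball x R) \<noteq> {})"

definition delone :: "'a::metric_space set \<Rightarrow> bool" where
  "delone D \<longleftrightarrow> uniformly_discrete D \<and> relatively_dense D"

definition UD_space :: "('a \<Rightarrow> 'a, 'a::metric_space, 'a set) pattern_space" where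
  "UD_space =
     \<lparr>patterns = {D. uniformly_discrete D},
      cut = (\<lambda>D C. D \<inter> C),
      act = (\<lambda>\<gamma>. \<lambda>D\<in>{D. uniformly_discrete D}. \<gamma> ` D)\<rparr>"

definition tile :: "'a::metric_space set \<Rightarrow> bool" where
  "tile T \<longleftrightarrow> open T \<and> T \<noteq> {} \<and> bounded T"

definition patch :: "'a::metric_space set set \<Rightarrow> bool" where
  "patch P \<longleftrightarrow> (\<forall>T\<in>P. tile T) \<and> (\<forall>S\<in>P. \<forall>T\<in>P. S = T \<or> S \<inter> T = {})"

definition Patch_space :: "('a \<Rightarrow> 'a, 'a::metric_space, 'a set set) pattern_space" where
  "Patch_space =
     \<lparr>patterns = {P. patch P},
      cut = (\<lambda>P C. {T \<in> P. T \<subseteq> C}),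
      act = (\<lambda>\<gamma>. \<lambda>P\<in>{P. patch P}. (\<lambda>T. \<gamma> ` T) ` P)\<rparr>"

definition tiling :: "'a::metric_space set set \<Rightarrow> bool" where
  "tiling P \<longleftrightarrow> patch P \<and> closure (\<Union>P) = UNIV"

subsection \<open>The punctured Voronoi tiling\<close>

definition voronoi_cell :: "'a::metric_space set \<Rightarrow> 'a \<Rightarrow> 'a set" where
  "voronoi_cell D x = {y. \<forall>x'\<in>D - {x}. dist x y < dist x' y}"

definition punctured_voronoi_tiling :: "'a::metric_space set \<Rightarrow> 'a set set" where
  "punctured_voronoi_tiling D = {voronoi_cell D x - {x} | x. x \<in> D}"

subsection \<open>The two instances are abstract pattern spaces\<close>

lemma isometry_group_simps [simp]:
  "f \<in> carrier isometry_group \<longleftrightarrow> bij f \<and> (\<forall>x y. dist (f x) (f y) = dist x y)"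
  "monoid.mult isometry_group = (\<circ>)" "one isometry_group = id"
  by (simp_all add: isometry_group_def)

lemma group_isometry_group: "group (isometry_group :: ('a::metric_space \<Rightarrow> 'a) monoid)"
proof (rule groupI)
  fix f :: "'a \<Rightarrow> 'a" assume f: "f \<in> carrier isometry_group"
  then have "inv_into UNIV f \<in> carrier isometry_group"
    by (auto simp: bij_imp_bij_inv) (metis bij_inv_eq_iff)
  moreover have "inv_into UNIV f \<circ> f = id"
    using f by (simp add: bij_is_inj)
  ultimately show "\<exists>g\<in>carrier isometry_group. g \<otimes>\<^bsub>isometry_group\<^esub> f = \<one>\<^bsub>isometry_group\<^esub>"
    by (intro bexI[of _ "inv_into UNIV f"]) simp_all
qed (auto simp: bij_comp o_assoc)

lemma group_actionI:
  fixes G (structure)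
  assumes G: "group G"
    and ext: "\<And>g. g \<in> carrier G \<Longrightarrow> f g \<in> extensional E"
    and clo: "\<And>g x. g \<in> carrier G \<Longrightarrow> x \<in> E \<Longrightarrow> f g x \<in> E"
    and mul: "\<And>g h x. \<lbrakk>g \<in> carrier G; h \<in> carrier G; x \<in> E\<rbrakk> \<Longrightarrow> f (g \<otimes>\<^bsub>G\<^esub> h) x = f g (f h x)"
    and one: "\<And>x. x \<in> E \<Longrightarrow> f \<one>\<^bsub>G\<^esub> x = x"
  shows "group_action G E f"
proof -
  interpret group G by (rule G)
  have bij: "f g \<in> Bij E" if g: "g \<in> carrier G" for g
  proof -
    have "bij_betw (f g) E E"
    proof (rule bij_betw_byWitness[where f' = "f (inv g)"])
      show "\<forall>x\<in>E. f (inv g) (f g x) = x"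
        using g by (metis inv_closed l_inv mul one)
      show "\<forall>x\<in>E. f g (f (inv g) x) = x"
        using g by (metis inv_closed r_inv mul one)
    qed (use g clo in auto)
    then show ?thesis using ext[OF g] by (simp add: Bij_def)
  qed
  have "f \<in> hom G (BijGroup E)"
  proof (rule homI)
    fix g h assume gh: "g \<in> carrier G" "h \<in> carrier G"
    have "f (g \<otimes> h) = compose E (f g) (f h)"
      using gh ext[of "g \<otimes> h"] mul
      by (intro extensionalityI[of _ E]) (auto simp: compose_def)
    then show "f (g \<otimes> h) = f g \<otimes>\<^bsub>BijGroup E\<^esub> f h"
      using gh bij by (simp add: BijGroup_def)
  qed (use bij in \<open>simp add: BijGroup_def\<close>)
  then show ?thesis
    using G group_BijGroup[of E]
    by (simp add: group_action_def group_hom_def group_hom_axioms_def)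
qed

context
  fixes \<Gamma> :: "('a::metric_space \<Rightarrow> 'a) set"
  assumes \<Gamma>: "subgroup \<Gamma> isometry_group"
begin

lemma \<Gamma>_bij: "g \<in> \<Gamma> \<Longrightarrow> bij g"
  and \<Gamma>_dist: "g \<in> \<Gamma> \<Longrightarrow> dist (g x) (g y) = dist x y"
  using subgroup.subset[OF \<Gamma>] by auto

lemma \<Gamma>_group: "group (subgroup_of_isometries \<Gamma>)"
  by (rule subgroup.subgroup_is_group[OF \<Gamma> group_isometry_group])

lemma \<Gamma>_continuous: "g \<in> \<Gamma> \<Longrightarrow> continuous_on UNIV g"
  by (auto simp: continuous_on_iff \<Gamma>_dist)

lemma \<Gamma>_homeomorphism:
  assumes "g \<in> \<Gamma>"
  shows "\<exists>h. homeomorphism UNIV UNIV g h"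
proof -
  obtain h where h: "\<And>x. h (g x) = x" "\<And>x. g (h x) = x"
    using \<Gamma>_bij[OF assms] by (metis bij_inv_eq_iff)
  have "dist (h x) (h y) = dist x y" for x y
    by (metis \<Gamma>_dist[OF assms] h(2))
  then have "continuous_on UNIV h" by (auto simp: continuous_on_iff)
  then show ?thesis
    using h \<Gamma>_continuous[OF assms]
    by (intro exI[of _ h] homeomorphismI) auto
qed

lemma \<Gamma>_open: "g \<in> \<Gamma> \<Longrightarrow> open T \<Longrightarrow> open (g ` T)"
  using \<Gamma>_homeomorphism[of g] homeomorphism_imp_open_map[of UNIV UNIV g _ T] by auto

lemma \<Gamma>_bounded: "g \<in> \<Gamma> \<Longrightarrow> bounded T \<Longrightarrow> bounded (g ` T)"
  unfolding bounded_def by (auto simp: \<Gamma>_dist) (metis \<Gamma>_dist)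

lemma \<Gamma>_action: "group_action (subgroup_of_isometries \<Gamma>) UNIV (\<lambda>g. g)"
  by (rule group_actionI[OF \<Gamma>_group]) auto

lemma \<Gamma>_uniformly_discrete: "g \<in> \<Gamma> \<Longrightarrow> uniformly_discrete D \<Longrightarrow> uniformly_discrete (g ` D)"
  unfolding uniformly_discrete_def by (auto simp: \<Gamma>_dist) (metis \<Gamma>_dist)

lemma \<Gamma>_patch:
  assumes g: "g \<in> \<Gamma>" and P: "patch P"
  shows "patch ((\<lambda>T. g ` T) ` P)"
proof -
  have "tile (g ` T)" if "T \<in> P" for T
    using that P \<Gamma>_open[OF g] \<Gamma>_bounded[OF g] by (auto simp: patch_def tile_def)
  moreover have "g ` S = g ` T \<or> g ` S \<inter> g ` T = {}" if "S \<in> P" "T \<in> P" for S T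
    using that P bij_is_inj[OF \<Gamma>_bij[OF g]] by (metis image_Int image_empty patch_def)
  ultimately show ?thesis by (auto simp: patch_def)
qed

theorem abstract_pattern_space_UD:
  "abstract_pattern_space (subgroup_of_isometries \<Gamma>) (\<lambda>g. g) UD_space"
proof (rule abstract_pattern_space.intro)
  show "group_action (subgroup_of_isometries \<Gamma>) UNIV (\<lambda>g. g)" by (rule \<Gamma>_action)
  show "\<exists>h. homeomorphism UNIV UNIV g h" if "g \<in> carrier (subgroup_of_isometries \<Gamma>)" for g
    using that \<Gamma>_homeomorphism by simp
  show "group_action (subgroup_of_isometries \<Gamma>) (patterns UD_space) (act UD_space)"
    by (rule group_actionI[OF \<Gamma>_group])
      (auto simp: UD_space_def \<Gamma>_uniformly_discrete image_comp)
  show "patterns (UD_space :: ('a \<Rightarrow> 'a, 'a, 'a set) pattern_space) \<noteq> {}"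
    by (auto simp: UD_space_def uniformly_discrete_def intro!: exI[of _ "{}"] exI[of _ 1])
  have sub: "uniformly_discrete (D \<inter> C)" if "uniformly_discrete D" for D C :: "'a set"
    using that unfolding uniformly_discrete_def by blast
  fix D C :: "'a set" assume D: "D \<in> patterns UD_space"
  show "cut UD_space D C \<in> patterns UD_space"
    using D sub by (simp add: UD_space_def)
  show "cut UD_space (cut UD_space D C) C2 = cut UD_space D (C \<inter> C2)" for C2
    by (auto simp: UD_space_def)
  have "(cut UD_space D C = D) \<longleftrightarrow> closure D \<subseteq> C" if "closed C" for C
    using closure_minimal[OF _ that, of D] closure_subset[of D] by (auto simp: UD_space_def)
  then show "\<exists>!K. closed K \<and> (\<forall>C. closed C \<longrightarrow> (cut UD_space D C = D \<longleftrightarrow> K \<subseteq> C))"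
    by (intro ex1I[of _ "closure D"]) (simp, metis closed_closure subset_antisym subset_refl)
  show "cut UD_space (act UD_space g D) (g ` C) = act UD_space g (cut UD_space D C)"
    if "g \<in> carrier (subgroup_of_isometries \<Gamma>)" for g
    using that D sub[of D C] bij_is_inj[OF \<Gamma>_bij[of g]]
    by (simp add: UD_space_def image_Int)
qed

theorem abstract_pattern_space_Patch:
  "abstract_pattern_space (subgroup_of_isometries \<Gamma>) (\<lambda>g. g) Patch_space"
proof (rule abstract_pattern_space.intro)
  show "group_action (subgroup_of_isometries \<Gamma>) UNIV (\<lambda>g. g)" by (rule \<Gamma>_action)
  show "\<exists>h. homeomorphism UNIV UNIV g h" if "g \<in> carrier (subgroup_of_isometries \<Gamma>)" for g
    using that \<Gamma>_homeomorphism by simp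
  show "group_action (subgroup_of_isometries \<Gamma>) (patterns Patch_space) (act Patch_space)"
    by (rule group_actionI[OF \<Gamma>_group])
      (auto simp: Patch_space_def \<Gamma>_patch image_comp image_image)
  show "patterns (Patch_space :: ('a \<Rightarrow> 'a, 'a, 'a set set) pattern_space) \<noteq> {}"
    by (auto simp: Patch_space_def patch_def intro!: exI[of _ "{}"])
  have sub: "patch {T \<in> P. T \<subseteq> C}" if "patch P" for P and C :: "'a set"
    using that unfolding patch_def by blast
  fix P :: "'a set set" and C :: "'a set" assume P: "P \<in> patterns Patch_space"
  show "cut Patch_space P C \<in> patterns Patch_space"
    using P sub by (simp add: Patch_space_def)
  show "cut Patch_space (cut Patch_space P C) C2 = cut Patch_space P (C \<inter> C2)" for C2
    by (auto simp: Patch_space_def)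
  have "(cut Patch_space P C = P) \<longleftrightarrow> closure (\<Union>P) \<subseteq> C" if "closed C" for C
    using closure_minimal[OF _ that, of "\<Union>P"] closure_subset[of "\<Union>P"]
    by (auto simp: Patch_space_def)
  then show "\<exists>!K. closed K \<and> (\<forall>C. closed C \<longrightarrow> (cut Patch_space P C = P \<longleftrightarrow> K \<subseteq> C))"
    by (intro ex1I[of _ "closure (\<Union>P)"]) (simp, metis closed_closure subset_antisym subset_refl)
  show "cut Patch_space (act Patch_space g P) (g ` C) = act Patch_space g (cut Patch_space P C)"
    if "g \<in> carrier (subgroup_of_isometries \<Gamma>)" for g
  proof -
    have "inj g" using that bij_is_inj[OF \<Gamma>_bij[of g]] by simp
    then show ?thesis
      using P sub[of P C] by (auto simp: Patch_space_def inj_image_subset_iff)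
  qed
qed

end

lemma pattern_supp_Patch: "pattern_supp Patch_space P = closure (\<Union>P)"
proof -
  have "(cut Patch_space P C = P) \<longleftrightarrow> closure (\<Union>P) \<subseteq> C" if "closed C" for C
    using closure_minimal[OF _ that, of "\<Union>P"] closure_subset[of "\<Union>P"]
    by (auto simp: Patch_space_def)
  then show ?thesis
    unfolding pattern_supp_def
    by (intro the_equality) (simp, metis closed_closure subset_antisym subset_refl)
qed

end

theory Submission
  imports Defs
begin

text \<open>
  Let \<open>R\<close> be such that every point lies within \<open>R\<close> of the Delone set \<open>D\<close>. Two facts about the
  cells carry the proof.

  A cell reaches at most \<open>R\<close> from its centre, so only the points of \<open>D\<close> within \<open>2 * R\<close> of the
  centre can take part in shaping it. As the centre is a limit point of the punctured cell, a
  punctured cell inside a ball has its centre in that ball, and the points of \<open>D\<close> in the ball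
  enlarged by \<open>2 * R\<close> determine it (\<open>voronoi_tile_from_points\<close>).

  Conversely, a punctured cell remembers its centre: it is an open set from which the centre is
  missing, whereas a cell with a different centre, being star-shaped around that one, cannot
  contain a punctured neighbourhood of a point without containing the point
  (\<open>voronoi_center_unique\<close>). Hence the tiles in the ball enlarged by \<open>R\<close> reveal the points
  of \<open>D\<close> in the ball (\<open>point_from_voronoi_tiles\<close>).

  Both arguments compare two discrete sets with the same \<open>R\<close>. For local derivability these are two
  isometric images of \<open>D\<close>, and an isometry carries the cells of \<open>D\<close> to the cells of the image.
  That the tiles cover a dense set follows from star-shapedness again: moving from any point
  towards a nearest point of \<open>D\<close> leads at once into the cell of the latter.
\<close>

section \<open>Delone sets\<close>

definition within_distance_of :: "real \<Rightarrow> 'a::metric_space set \<Rightarrow> bool" where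
  "within_distance_of R D \<longleftrightarrow> (\<forall>y. \<exists>p\<in>D. dist p y \<le> R)"

lemma relatively_dense_within_distance:
  assumes "relatively_dense D"
  obtains R where "R > 0" "within_distance_of R D"
proof -
  obtain R where R: "R > 0" "\<And>y. D \<inter> interior (cball y R) \<noteq> {}"
    using assms by (auto simp: relatively_dense_def)
  have "\<exists>p\<in>D. dist p y \<le> R" for y
    using R(2)[of y] interior_subset[of "cball y R"] by (fastforce simp: dist_commute)
  then show thesis using that R(1) by (auto simp: within_distance_of_def)
qed

lemma closed_uniformly_discrete:
  fixes D :: "'a::heine_borel set"
  assumes "uniformly_discrete D" "A \<subseteq> D"
  shows "closed A"
proof -
  obtain r where r: "r > 0" "\<And>x y. x \<in> D \<Longrightarrow> y \<in> D \<Longrightarrow> x \<noteq> y \<Longrightarrow> dist x y > r"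
    using assms(1) by (auto simp: uniformly_discrete_def)
  show ?thesis
    by (rule discrete_imp_closed[OF r(1)]) (use r(2) assms(2) in force)
qed

lemma subset_closure_punctured:
  fixes S :: "'a::{perfect_space,metric_space} set"
  assumes "open S"
  shows "S \<subseteq> closure (S - {x})"
proof
  fix y assume "y \<in> S"
  then have "y islimpt S - {y}"
    using interior_limit_point[of y S] interior_open[OF assms] islimpt_punctured by blast
  then show "y \<in> closure (S - {x})"
    using \<open>y \<in> S\<close> by (cases "y = x") (auto simp: closure_def)
qed

section \<open>Geometry of Voronoi cells\<close>

lemma center_in_voronoi_cell: "x \<in> voronoi_cell D x"
  by (auto simp: voronoi_cell_def)

lemma voronoi_cell_subset_cball:
  assumes "within_distance_of R D"
  shows "voronoi_cell D x \<subseteq> cball x R"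
proof
  fix y assume y: "y \<in> voronoi_cell D x"
  obtain p where "p \<in> D" "dist p y \<le> R"
    using assms by (auto simp: within_distance_of_def)
  then show "y \<in> cball x R"
    using y by (cases "p = x") (auto simp: voronoi_cell_def intro: less_imp_le less_le_trans)
qed

text \<open>
  The cell is cut out by possibly infinitely many open conditions; they amount to the single one
  that \<open>x\<close> is closer than the distance to the rest of \<open>D\<close>, as that distance is attained.
\<close>

lemma open_voronoi_cell:
  fixes D :: "'a::heine_borel set"
  assumes "uniformly_discrete D"
  shows "open (voronoi_cell D x)"
proof (cases "D - {x} = {}")
  case True
  then have "voronoi_cell D x = UNIV" unfolding voronoi_cell_def by blast
  then show ?thesis by simp
next
  case False
  have cl: "closed (D - {x})" by (rule closed_uniformly_discrete[OF assms]) auto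
  have "y \<in> voronoi_cell D x \<longleftrightarrow> dist x y < infdist y (D - {x})" for y
  proof
    assume y: "y \<in> voronoi_cell D x"
    obtain p where "p \<in> D - {x}" "infdist y (D - {x}) = dist y p"
      using infdist_attains_inf[OF cl False] by metis
    then show "dist x y < infdist y (D - {x})"
      using y by (auto simp: voronoi_cell_def dist_commute)
  next
    assume less: "dist x y < infdist y (D - {x})"
    have "dist x y < dist x' y" if "x' \<in> D - {x}" for x'
      using less infdist_le[OF that, of y] by (simp add: dist_commute)
    then show "y \<in> voronoi_cell D x" by (simp add: voronoi_cell_def)
  qed
  then have "voronoi_cell D x = {y. dist x y < infdist y (D - {x})}" by blast
  then show ?thesis
    by (simp add: open_Collect_less continuous_intros)
qed

text \<open>
  With \<open>u = x - y\<close> and \<open>v = x' - y\<close>, the squared distances of \<open>y + t *\<^sub>R u\<close> to \<open>x'\<close> and to \<open>x\<close>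
  differ by \<open>(1 - t) * ((norm v)\<^sup>2 - (norm u)\<^sup>2) + t * (norm (u - v))\<^sup>2\<close>. For \<open>t > 0\<close> the second
  summand makes this positive, so that a weak inequality at \<open>y\<close> becomes strict.
\<close>

lemma voronoi_cell_starlike:
  fixes D :: "'a::real_inner set"
  assumes weak: "\<And>x'. x' \<in> D \<Longrightarrow> dist x y \<le> dist x' y"
    and t: "0 < t" "t \<le> 1"
  shows "y + t *\<^sub>R (x - y) \<in> voronoi_cell D x"
proof -
  have "dist x (y + t *\<^sub>R (x - y)) < dist x' (y + t *\<^sub>R (x - y))" if x': "x' \<in> D" "x' \<noteq> x" for x'
  proof -
    define u v where "u = x - y" and "v = x' - y"
    have le: "(norm u)\<^sup>2 \<le> (norm v)\<^sup>2"
      using weak[OF x'(1)] by (simp add: u_def v_def dist_norm power_mono)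
    have "u - v \<noteq> 0" using x'(2) by (simp add: u_def v_def)
    then have pos: "0 < t * (norm (u - v))\<^sup>2" using t by simp
    have "(norm (v - t *\<^sub>R u))\<^sup>2 - (norm (u - t *\<^sub>R u))\<^sup>2
        = (1 - t) * ((norm v)\<^sup>2 - (norm u)\<^sup>2) + t * (norm (u - v))\<^sup>2"
      by (simp add: power2_norm_eq_inner inner_diff inner_commute[of v u] algebra_simps)
    also have "\<dots> > 0"
      using le t pos by (intro add_nonneg_pos mult_nonneg_nonneg) auto
    finally have "norm (u - t *\<^sub>R u) < norm (v - t *\<^sub>R u)"
      by (simp add: power2_less_imp_less)
    then show ?thesis by (simp add: u_def v_def dist_norm algebra_simps)
  qed
  then show ?thesis by (simp add: voronoi_cell_def)
qed

lemma closure_Union_punctured_voronoi: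
  fixes D :: "'a::euclidean_space set"
  assumes "uniformly_discrete D" "D \<noteq> {}"
  shows "closure (\<Union>(punctured_voronoi_tiling D)) = UNIV"
proof -
  have "y \<in> closure (\<Union>(punctured_voronoi_tiling D))" for y
  proof -
    have "closed D" by (rule closed_uniformly_discrete[OF assms(1) subset_refl])
    then obtain x where x: "x \<in> D" "infdist y D = dist y x"
      using infdist_attains_inf assms(2) by metis
    have weak: "dist x y \<le> dist x' y" if "x' \<in> D" for x'
      using infdist_le[OF that, of y] x(2) by (simp add: dist_commute)
    have "(\<lambda>n. y + inverse (real (Suc n)) *\<^sub>R (x - y)) \<longlonglongrightarrow> y + 0 *\<^sub>R (x - y)"
      by (intro tendsto_intros LIMSEQ_inverse_real_of_nat)
    moreover have "y + inverse (real (Suc n)) *\<^sub>R (x - y) \<in> voronoi_cell D x" for n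
      by (rule voronoi_cell_starlike[OF weak]) (auto simp: field_simps)
    ultimately have "y \<in> closure (voronoi_cell D x)"
      unfolding closure_sequential
      by (intro exI[of _ "\<lambda>n. y + inverse (real (Suc n)) *\<^sub>R (x - y)"]) simp
    also have "\<dots> \<subseteq> closure (voronoi_cell D x - {x})"
      using subset_closure_punctured[OF open_voronoi_cell[OF assms(1)]]
      by (rule closure_minimal) simp
    also have "\<dots> \<subseteq> closure (\<Union>(punctured_voronoi_tiling D))"
      using x(1) by (intro closure_mono) (auto simp: punctured_voronoi_tiling_def)
    finally show ?thesis .
  qed
  then show ?thesis by auto
qed

lemma tiling_punctured_voronoi:
  fixes D :: "'a::euclidean_space set"
  assumes ud: "uniformly_discrete D" and R: "within_distance_of R D"
  shows "tiling (punctured_voronoi_tiling D)"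
proof -
  have "tile (voronoi_cell D x - {x})" for x
  proof -
    have "voronoi_cell D x \<noteq> {x}"
      using open_voronoi_cell[OF ud, of x] not_open_singleton[of x] by metis
    then have "voronoi_cell D x - {x} \<noteq> {}"
      using center_in_voronoi_cell by blast
    moreover have "bounded (voronoi_cell D x - {x})"
      using voronoi_cell_subset_cball[OF R, of x] by (meson Diff_subset bounded_cball bounded_subset)
    ultimately show ?thesis
      using open_voronoi_cell[OF ud, of x] by (auto simp: tile_def open_delete)
  qed
  moreover have "voronoi_cell D x \<inter> voronoi_cell D x' = {}"
    if "x \<in> D" "x' \<in> D" "x \<noteq> x'" for x x'
  proof -
    have "dist x y < dist x' y \<and> dist x' y < dist x y"
      if "y \<in> voronoi_cell D x" "y \<in> voronoi_cell D x'" for y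
      using that \<open>x \<in> D\<close> \<open>x' \<in> D\<close> \<open>x \<noteq> x'\<close> by (auto simp: voronoi_cell_def)
    then show ?thesis by fastforce
  qed
  ultimately have "patch (punctured_voronoi_tiling D)"
    unfolding patch_def punctured_voronoi_tiling_def by blast
  moreover have "D \<noteq> {}" using R by (auto simp: within_distance_of_def)
  ultimately show ?thesis
    using closure_Union_punctured_voronoi[OF ud] by (simp add: tiling_def)
qed

section \<open>Points and tiles determine each other locally\<close>

text \<open>
  If \<open>y\<close> is in the cell of \<open>x\<close> for \<open>D\<close>, it lies within \<open>R\<close> of \<open>x\<close>. A point of \<open>D'\<close> that
  excludes \<open>y\<close> from the cell for \<open>D'\<close> is no farther from \<open>y\<close>, so it is within \<open>2 * R\<close> of \<open>x\<close>
  and hence belongs to \<open>D\<close>, where it would exclude \<open>y\<close> as well.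
\<close>

lemma voronoi_cell_subset:
  assumes R: "within_distance_of R D" and sub: "D' \<inter> cball x (2 * R) \<subseteq> D"
  shows "voronoi_cell D x \<subseteq> voronoi_cell D' x"
proof
  fix y assume y: "y \<in> voronoi_cell D x"
  then have yR: "dist x y \<le> R" using voronoi_cell_subset_cball[OF R] by fastforce
  have "dist x y < dist x' y" if x': "x' \<in> D'" "x' \<noteq> x" for x'
  proof (rule ccontr)
    assume not_less: "\<not> dist x y < dist x' y"
    have "dist x x' \<le> dist x y + dist x' y" by (rule dist_triangle2)
    then have "x' \<in> D" using not_less x'(1) sub yR by (auto simp: subset_iff)
    then show False using y x'(2) not_less by (auto simp: voronoi_cell_def)
  qed
  then show "y \<in> voronoi_cell D' x" by (simp add: voronoi_cell_def)
qed

lemma voronoi_tile_from_points: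
  fixes D D' :: "'a::euclidean_space set"
  assumes ud: "uniformly_discrete D"
    and R: "R \<ge> 0" "within_distance_of R D" "within_distance_of R D'"
    and eq: "D \<inter> cball a (s + 2 * R) = D' \<inter> cball a (s + 2 * R)"
    and T: "T \<in> punctured_voronoi_tiling D" "T \<subseteq> cball a s"
  shows "T \<in> punctured_voronoi_tiling D'"
proof -
  obtain x where x: "x \<in> D" "T = voronoi_cell D x - {x}"
    using T(1) by (auto simp: punctured_voronoi_tiling_def)
  have "x \<in> closure T"
    using subset_closure_punctured[OF open_voronoi_cell[OF ud]] center_in_voronoi_cell x(2)
    by blast
  also have "closure T \<subseteq> cball a s" by (rule closure_minimal[OF T(2)]) simp
  finally have xs: "dist a x \<le> s" by simp
  then have near: "cball x (2 * R) \<subseteq> cball a (s + 2 * R)" by (simp add: cball_subset_cball_iff dist_commute)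
  have "voronoi_cell D x = voronoi_cell D' x"
  proof
    show "voronoi_cell D x \<subseteq> voronoi_cell D' x"
      by (rule voronoi_cell_subset[OF R(2)]) (use near eq in blast)
    show "voronoi_cell D' x \<subseteq> voronoi_cell D x"
      by (rule voronoi_cell_subset[OF R(3)]) (use near eq in blast)
  qed
  moreover have "x \<in> cball a (s + 2 * R)" using xs R(1) by simp
  then have "x \<in> D'" using x(1) eq by blast
  ultimately show ?thesis using x(2) by (auto simp: punctured_voronoi_tiling_def)
qed

text \<open>
  If \<open>x \<noteq> x'\<close>, then a point \<open>p\<close> slightly beyond \<open>x\<close> as seen from \<open>x'\<close> lies in the common
  punctured cell, hence so does \<open>x\<close>, as it is on the way from \<open>p\<close> to \<open>x'\<close>. But \<open>x\<close> was removed.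
\<close>

lemma voronoi_center_unique:
  fixes D D' :: "'a::euclidean_space set"
  assumes ud: "uniformly_discrete D"
    and eq: "voronoi_cell D x - {x} = voronoi_cell D' x' - {x'}"
  shows "x = x'"
proof (rule ccontr)
  assume ne: "x \<noteq> x'"
  obtain e where e: "e > 0" "ball x e \<subseteq> voronoi_cell D x"
    using open_voronoi_cell[OF ud] center_in_voronoi_cell open_contains_ball by blast
  define c where "c = e / (2 * dist x x')"
  define p where "p = x + c *\<^sub>R (x - x')"
  have c: "c > 0" using e ne by (simp add: c_def)
  have "dist x p = c * dist x x'" using c by (simp add: p_def dist_norm)
  also have "\<dots> = e / 2" using ne by (simp add: c_def)
  finally have "dist x p = e / 2" .
  then have "p \<in> voronoi_cell D x - {x}" using e by auto
  then have p: "p \<in> voronoi_cell D' x'" using eq by blast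
  have weak: "dist x' p \<le> dist z p" if "z \<in> D'" for z
    using p that by (cases "z = x'") (auto simp: voronoi_cell_def intro: less_imp_le)
  \<comment> \<open>The factor is chosen such that this point on the way from \<open>p\<close> to \<open>x'\<close> is \<open>x\<close>.\<close>
  have on_way: "p + (c / (1 + c)) *\<^sub>R (x' - p) \<in> voronoi_cell D' x'"
    by (rule voronoi_cell_starlike[OF weak]) (use c in auto)
  have "x' - p = - (1 + c) *\<^sub>R (x - x')"
    by (simp add: p_def algebra_simps)
  then have "(c / (1 + c)) *\<^sub>R (x' - p) = (c / (1 + c) * - (1 + c)) *\<^sub>R (x - x')"
    by (simp only: scaleR_scaleR)
  moreover have "c / (1 + c) * - (1 + c) = - c" using c by (simp add: field_simps)
  ultimately have "p + (c / (1 + c)) *\<^sub>R (x' - p) = x" by (simp add: p_def)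
  with on_way have "x \<in> voronoi_cell D' x' - {x'}" using ne by simp
  then show False using eq by blast
qed

lemma point_from_voronoi_tiles:
  fixes D D' :: "'a::euclidean_space set"
  assumes ud: "uniformly_discrete D" and R: "within_distance_of R D"
    and eq: "{T \<in> punctured_voronoi_tiling D. T \<subseteq> cball a (s + R)}
      \<subseteq> punctured_voronoi_tiling D'"
    and x: "x \<in> D" "x \<in> cball a s"
  shows "x \<in> D'"
proof -
  have "cball x R \<subseteq> cball a (s + R)"
    using x(2) by (simp add: cball_subset_cball_iff dist_commute)
  then have "voronoi_cell D x - {x} \<subseteq> cball a (s + R)"
    using voronoi_cell_subset_cball[OF R] by blast
  then have "voronoi_cell D x - {x} \<in> punctured_voronoi_tiling D'"
    using eq x(1) by (auto simp: punctured_voronoi_tiling_def)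
  then obtain x' where "x' \<in> D'" "voronoi_cell D x - {x} = voronoi_cell D' x' - {x'}"
    by (auto simp: punctured_voronoi_tiling_def)
  then show ?thesis using voronoi_center_unique[OF ud] by metis
qed

section \<open>Equivariance and mutual local derivability\<close>

lemma isometry_image_voronoi_cell:
  assumes bij: "bij g" and iso: "\<And>x y. dist (g x) (g y) = dist x y"
  shows "g ` voronoi_cell D x = voronoi_cell (g ` D) (g x)"
proof -
  have "g ` D - {g x} = g ` (D - {x})"
    using image_set_diff[OF bij_is_inj[OF bij], of D "{x}"] by simp
  then have "g -` voronoi_cell (g ` D) (g x) = voronoi_cell D x"
    by (simp add: voronoi_cell_def iso vimage_def)
  then show ?thesis
    using surj_image_vimage_eq[OF bij_is_surj[OF bij]] by metis
qed

lemma isometry_image_voronoi_tiling: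
  assumes bij: "bij g" and iso: "\<And>x y. dist (g x) (g y) = dist x y"
  shows "(\<lambda>T. g ` T) ` punctured_voronoi_tiling D = punctured_voronoi_tiling (g ` D)"
proof -
  have "g ` (voronoi_cell D x - {x}) = voronoi_cell (g ` D) (g x) - {g x}" for x
    using image_set_diff[OF bij_is_inj[OF bij], of "voronoi_cell D x" "{x}"]
    by (simp add: isometry_image_voronoi_cell[OF bij iso])
  then show ?thesis
    by (simp add: punctured_voronoi_tiling_def Setcompr_eq_image image_image)
qed

lemma isometry_image_within_distance:
  assumes bij: "bij g" and iso: "\<And>x y. dist (g x) (g y) = dist x y"
    and R: "within_distance_of R D"
  shows "within_distance_of R (g ` D)"
  unfolding within_distance_of_def
proof
  fix z
  obtain y where "z = g y" using bij_is_surj[OF bij] by (metis surjD)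
  then show "\<exists>p\<in>g ` D. dist p z \<le> R"
    using R by (auto simp: within_distance_of_def iso)
qed

theorem mutually_locally_derivable_voronoi:
  fixes D :: "'a::euclidean_space set"
  assumes \<Gamma>: "subgroup \<Gamma> isometry_group" and delone: "delone D"
  shows "mutually_locally_derivable (subgroup_of_isometries \<Gamma>)
    UD_space D Patch_space (punctured_voronoi_tiling D)"
proof -
  have ud: "uniformly_discrete D" using delone by (simp add: delone_def)
  obtain R where R: "R > 0" "within_distance_of R D"
    using relatively_dense_within_distance delone by (auto simp: delone_def)
  have patch: "patch (punctured_voronoi_tiling D)"
    using tiling_punctured_voronoi[OF ud R(2)] by (simp add: tiling_def)
  note iso = \<Gamma>_bij[OF \<Gamma>] \<Gamma>_dist[OF \<Gamma>]
  have udg: "uniformly_discrete (g ` D)" if "g \<in> \<Gamma>" for g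
    by (rule \<Gamma>_uniformly_discrete[OF \<Gamma> that ud])
  have Rg: "within_distance_of R (g ` D)" if "g \<in> \<Gamma>" for g
    by (rule isometry_image_within_distance[OF iso[OF that] R(2)])
  have cutD: "cut UD_space (act UD_space g D) C = g ` D \<inter> C" for g C
    by (simp add: UD_space_def ud)
  have cutT: "cut Patch_space (act Patch_space g (punctured_voronoi_tiling D)) C
      = {T \<in> punctured_voronoi_tiling (g ` D). T \<subseteq> C}" if "g \<in> \<Gamma>" for g C
    by (simp add: Patch_space_def patch isometry_image_voronoi_tiling[OF iso[OF that]])
  have "locally_derivable (subgroup_of_isometries \<Gamma>)
      UD_space D Patch_space (punctured_voronoi_tiling D)"
    unfolding locally_derivable_def
  proof (intro exI[of _ "0 :: 'a"] exI[of _ "2 * R"] conjI ballI allI impI)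
    fix g h s
    assume "g \<in> carrier (subgroup_of_isometries \<Gamma>)" "h \<in> carrier (subgroup_of_isometries \<Gamma>)"
      and eq: "cut UD_space (act UD_space g D) (cball 0 (s + 2 * R))
        = cut UD_space (act UD_space h D) (cball 0 (s + 2 * R))"
    then have g: "g \<in> \<Gamma>" and h: "h \<in> \<Gamma>" by simp_all
    note eq = eq[unfolded cutD]
    show "cut Patch_space (act Patch_space g (punctured_voronoi_tiling D)) (cball 0 s)
      = cut Patch_space (act Patch_space h (punctured_voronoi_tiling D)) (cball 0 s)"
      unfolding cutT[OF g] cutT[OF h]
      using voronoi_tile_from_points[OF udg[OF g] less_imp_le[OF R(1)] Rg[OF g] Rg[OF h] eq]
        voronoi_tile_from_points[OF udg[OF h] less_imp_le[OF R(1)] Rg[OF h] Rg[OF g] eq[symmetric]]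
      by blast
  qed (use R in simp)
  moreover have "locally_derivable (subgroup_of_isometries \<Gamma>)
      Patch_space (punctured_voronoi_tiling D) UD_space D"
    unfolding locally_derivable_def
  proof (intro exI[of _ "0 :: 'a"] exI[of _ R] conjI ballI allI impI)
    fix g h s
    assume "g \<in> carrier (subgroup_of_isometries \<Gamma>)" "h \<in> carrier (subgroup_of_isometries \<Gamma>)"
      and eq: "cut Patch_space (act Patch_space g (punctured_voronoi_tiling D)) (cball 0 (s + R))
        = cut Patch_space (act Patch_space h (punctured_voronoi_tiling D)) (cball 0 (s + R))"
    then have g: "g \<in> \<Gamma>" and h: "h \<in> \<Gamma>" by simp_all
    note eq = eq[unfolded cutT[OF g] cutT[OF h]]
    have "{T \<in> punctured_voronoi_tiling (g ` D). T \<subseteq> cball 0 (s + R)}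
        \<subseteq> punctured_voronoi_tiling (h ` D)"
      and "{T \<in> punctured_voronoi_tiling (h ` D). T \<subseteq> cball 0 (s + R)}
        \<subseteq> punctured_voronoi_tiling (g ` D)"
      using eq by blast+
    then show "cut UD_space (act UD_space g D) (cball 0 s) = cut UD_space (act UD_space h D) (cball 0 s)"
      unfolding cutD
      using point_from_voronoi_tiles[OF udg[OF g] Rg[OF g]]
        point_from_voronoi_tiles[OF udg[OF h] Rg[OF h]]
      by blast
  qed (use R in simp)
  ultimately show ?thesis by (simp add: mutually_locally_derivable_def)
qed

theorem proposition3p32:
  fixes \<Gamma> :: "(real ^ 'n \<Rightarrow> real ^ 'n) set" and D :: "(real ^ 'n) set"
  assumes "closed_isometry_subgroup \<Gamma>"
    and "delone D"
  shows "tiling (punctured_voronoi_tiling D) \<and>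
    mutually_locally_derivable (subgroup_of_isometries \<Gamma>)
      UD_space D Patch_space (punctured_voronoi_tiling D)"
proof
  obtain R where "within_distance_of R D"
    using relatively_dense_within_distance assms(2) by (auto simp: delone_def)
  then show "tiling (punctured_voronoi_tiling D)"
    using tiling_punctured_voronoi assms(2) by (auto simp: delone_def)
  show "mutually_locally_derivable (subgroup_of_isometries \<Gamma>)
      UD_space D Patch_space (punctured_voronoi_tiling D)"
    using mutually_locally_derivable_voronoi assms by (auto simp: closed_isometry_subgroup_def)
qed

end
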